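(* Let $A<B$, let $\lambda>0$ be fixed, and let $f:[A,B]\to\mathbb{R}$ be twice continuously differentiable with $f(t)\ne0$ for all $t\in[A,B]$. For each $N$ put $\Delta=(B-A)/(N-1)$, $t_j=A+(j-1)\Delta$ ($j=1,\dots,N$), $a=e^{-\lambda\Delta}\in(0,1)$, and consider the one-parameter regression model $y_j=\theta f(t_j)+\epsilon_j$, $j=1,\dots,N$, with $\mathrm{AR}(1)$ errors $\epsilon_j-a\epsilon_{j-1}=z_j$ ($j=2,\dots,N$), where $\epsilon_1\sim N(0,1)$ and $z_2,\dots,z_N$ are i.i.d. $N(0,1-a^2)$, independent of $\epsilon_1$. Define $$p(t)=-\frac{1}{2\lambda f(t)}\big(f''(t)-\lambda^2f(t)\big),\quad P_A=\frac{1}{2\lambda f(A)}\big(-f'(A)+\lambda f(A)\big),\quad P_B=\frac{1}{2\lambda f(B)}\big(f'(B)+\lambda f(B)\big),$$ $$D^*=\Big(P_Af^2(A)+P_Bf^2(B)+\int_A^Bp(t)f^2(t)\,dt\Big)^{-1}.$$ Then, for large $N$, the optimal discrete SLSE is approximated by the continuous SLSE $$\hat\theta=D^*\Big(P_Af(A)y(A)+P_Bf(B)y(B)+\int_A^Bp(t)f(t)y(t)\,dt\Big),$$ in the sense that $$D^*=\lim_{N\to\infty}\mathrm{Var}(\hat\theta_{\mathrm{SLSE},N}),$$ where $\mathrm{Var}(\hat\theta_{\mathrm{SLSE},N})$ is the variance of the signed least squares estimator under the optimal discrete design with $N$ points.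
   Context: Write $f_i=f(t_i)$, $\mathbf f=(f_1,\dots,f_N)^T$, and $\Sigma=(\mathbb{E}[\epsilon_i\epsilon_j])_{i,j=1}^N$, the covariance matrix of the errors; here $\Sigma_{ij}=a^{|i-j|}=e^{-\lambda|t_i-t_j|}$. A (signed) design on $\{t_1,\dots,t_N\}$ is given by real weights $w_1,\dots,w_N$ (defined up to a common nonzero factor). The variance of the signed least squares estimator (SLSE) for this design is $$\mathrm{Var}(\hat\theta_{\mathrm{SLSE},N})=\sum_{i=1}^N\sum_{j=1}^N\Sigma_{ij}w_iw_jf_if_j\Big/\Big(\sum_{i=1}^Nw_if_i^2\Big)^2 .$$ The optimal discrete design (optimal discrete SLSE) is the one with weights $w_i^*=\mathbf e_i^T\Sigma^{-1}\mathbf f/f_i$, $i=1,\dots,N$, where $\mathbf e_i$ is the $i$-th unit vector of $\mathbb{R}^N$; these weights minimize $\sum_{i=1}^N\sum_{j=1}^N\Sigma_{ij}w_iw_jf_if_j\big/\big(\sum_{i=1}^Nw_if_i^2\big)^2$ over all real $w_1,\dots,w_N$ with $\sum_{i=1}^Nw_if_i^2\neq0$. In the continuous SLSE, $y(t)=\theta f(t)+\varepsilon(t)$, $t\in[A,B]$, where $\varepsilon$ is the continuous-time Gaussian AR(1) process with mean zero and autocovariance $e^{-\lambda|t|}$. *)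

theory Defs
  imports "HOL-Probability.Probability" "Jordan_Normal_Form.Gauss_Jordan_Elimination"
begin

definition design_step :: "real \<Rightarrow> real \<Rightarrow> nat \<Rightarrow> real" where
  "design_step A B N = (B - A) / (real N - 1)"

definition design_pt :: "real \<Rightarrow> real \<Rightarrow> nat \<Rightarrow> nat \<Rightarrow> real" where
  "design_pt A B N j = A + (real j - 1) * design_step A B N"

text \<open>The independent family consists of the initial error (index \<open>1\<close>) and the innovations
  \<open>z 2, \<dots>, z N\<close>; \<open>normal_density\<close> takes the standard deviation, not the variance.\<close>

definition ar1_errors ::
  "'a measure \<Rightarrow> nat \<Rightarrow> real \<Rightarrow> (nat \<Rightarrow> 'a \<Rightarrow> real) \<Rightarrow> (nat \<Rightarrow> 'a \<Rightarrow> real) \<Rightarrow> bool" where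
  "ar1_errors M N a \<epsilon> z \<longleftrightarrow>
     prob_space M \<and>
     distributed M lborel (\<epsilon> 1) (normal_density 0 1) \<and>
     (\<forall>j\<in>{2..N}. distributed M lborel (z j) (normal_density 0 (sqrt (1 - a\<^sup>2)))) \<and>
     prob_space.indep_vars M (\<lambda>_. borel) (\<lambda>j. if j = 1 then \<epsilon> 1 else z j) {1..N} \<and>
     (\<forall>j\<in>{2..N}. \<forall>\<omega>\<in>space M. \<epsilon> j \<omega> - a * \<epsilon> (j - 1) \<omega> = z j \<omega>)"

text \<open>Matrices and vectors of Jordan_Normal_Form are indexed from \<open>0\<close>, so the entry \<open>(i, j)\<close>
  belongs to the errors \<open>i + 1\<close> and \<open>j + 1\<close>.\<close>

definition error_cov :: "'a measure \<Rightarrow> nat \<Rightarrow> (nat \<Rightarrow> 'a \<Rightarrow> real) \<Rightarrow> real mat" where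
  "error_cov M N \<epsilon> =
     mat N N (\<lambda>(i, j). prob_space.expectation M (\<lambda>\<omega>. \<epsilon> (Suc i) \<omega> * \<epsilon> (Suc j) \<omega>))"

text \<open>The signed least squares estimator for weights \<open>w\<close>, regression values \<open>fv\<close> and observations
  \<open>y\<close>, all indexed by \<open>1, \<dots>, N\<close>.\<close>

definition slse :: "nat \<Rightarrow> (nat \<Rightarrow> real) \<Rightarrow> (nat \<Rightarrow> real) \<Rightarrow> (nat \<Rightarrow> real) \<Rightarrow> real" where
  "slse N w fv y = (\<Sum>i=1..N. w i * fv i * y i) / (\<Sum>i=1..N. w i * (fv i)\<^sup>2)"

definition optimal_weight :: "nat \<Rightarrow> real mat \<Rightarrow> (nat \<Rightarrow> real) \<Rightarrow> nat \<Rightarrow> real" where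
  "optimal_weight N \<Sigma> fv i =
     scalar_prod (unit_vec N (i - 1))
       (mult_mat_vec (the (mat_inverse \<Sigma>)) (vec N (\<lambda>k. fv (Suc k)))) / fv i"

text \<open>The familiar quadratic-form expression for the variance of the estimator:\<close>

lemma variance_slse:
  fixes \<epsilon> :: "nat \<Rightarrow> 'a \<Rightarrow> real"
  assumes M: "prob_space M"
    and meas: "\<And>i. i \<in> {1..N} \<Longrightarrow> \<epsilon> i \<in> borel_measurable M"
    and sq: "\<And>i. i \<in> {1..N} \<Longrightarrow> integrable M (\<lambda>\<omega>. (\<epsilon> i \<omega>)\<^sup>2)"
    and mean: "\<And>i. i \<in> {1..N} \<Longrightarrow> prob_space.expectation M (\<epsilon> i) = 0"
  shows "prob_space.variance M (\<lambda>\<omega>. slse N w fv (\<lambda>i. \<theta> * fv i + \<epsilon> i \<omega>)) =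
    (\<Sum>i=1..N. \<Sum>j=1..N. error_cov M N \<epsilon> $$ (i - 1, j - 1) * w i * w j * fv i * fv j) /
      (\<Sum>i=1..N. w i * (fv i)\<^sup>2)\<^sup>2"
proof -
  interpret prob_space M by (rule M)
  define S where "S = (\<Sum>i=1..N. w i * (fv i)\<^sup>2)"
  define L where "L \<omega> = (\<Sum>i=1..N. w i * fv i * \<epsilon> i \<omega>)" for \<omega>
  have int: "integrable M (\<epsilon> i)" if "i \<in> {1..N}" for i
    using square_integrable_imp_integrable[OF meas sq] that by blast
  have int2: "integrable M (\<lambda>\<omega>. \<epsilon> i \<omega> * \<epsilon> j \<omega>)" if "i \<in> {1..N}" "j \<in> {1..N}" for i j
  proof (rule Bochner_Integration.integrable_bound)
    show "integrable M (\<lambda>\<omega>. (\<epsilon> i \<omega>)\<^sup>2 + (\<epsilon> j \<omega>)\<^sup>2)" using sq that by auto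
    show "(\<lambda>\<omega>. \<epsilon> i \<omega> * \<epsilon> j \<omega>) \<in> borel_measurable M" using meas that by auto
    show "AE \<omega> in M. norm (\<epsilon> i \<omega> * \<epsilon> j \<omega>) \<le> norm ((\<epsilon> i \<omega>)\<^sup>2 + (\<epsilon> j \<omega>)\<^sup>2)"
    proof (rule AE_I2)
      fix \<omega>
      have "2 * \<bar>\<epsilon> i \<omega>\<bar> * \<bar>\<epsilon> j \<omega>\<bar> \<le> \<bar>\<epsilon> i \<omega>\<bar>\<^sup>2 + \<bar>\<epsilon> j \<omega>\<bar>\<^sup>2" by (rule sum_squares_bound)
      moreover have "0 \<le> \<bar>\<epsilon> i \<omega>\<bar> * \<bar>\<epsilon> j \<omega>\<bar>" by simp
      ultimately have "\<bar>\<epsilon> i \<omega>\<bar> * \<bar>\<epsilon> j \<omega>\<bar> \<le> (\<epsilon> i \<omega>)\<^sup>2 + (\<epsilon> j \<omega>)\<^sup>2"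
        unfolding power2_abs by linarith
      then show "norm (\<epsilon> i \<omega> * \<epsilon> j \<omega>) \<le> norm ((\<epsilon> i \<omega>)\<^sup>2 + (\<epsilon> j \<omega>)\<^sup>2)"
        by (simp add: abs_mult)
    qed
  qed
  have slse_eq: "slse N w fv (\<lambda>i. \<theta> * fv i + \<epsilon> i \<omega>) = \<theta> * S / S + L \<omega> / S" for \<omega>
    unfolding slse_def S_def L_def
    by (simp add: sum.distrib sum_distrib_left add_divide_distrib algebra_simps power2_eq_square)
  have L_int: "integrable M L" unfolding L_def using int by auto
  have EL: "expectation L = 0"
    unfolding L_def using int mean by (subst Bochner_Integration.integral_sum) auto
  have mean_eq: "expectation (\<lambda>\<omega>. \<theta> * S / S + L \<omega> / S) = \<theta> * S / S"
    using L_int EL by (simp add: prob_space)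
  have sqL: "(L \<omega>)\<^sup>2 = (\<Sum>i=1..N. \<Sum>j=1..N. w i * w j * fv i * fv j * (\<epsilon> i \<omega> * \<epsilon> j \<omega>))" for \<omega>
    unfolding L_def power2_eq_square sum_product by (simp add: mult_ac)
  have "expectation (\<lambda>\<omega>. (L \<omega>)\<^sup>2) =
      (\<Sum>i=1..N. \<Sum>j=1..N. w i * w j * fv i * fv j * expectation (\<lambda>\<omega>. \<epsilon> i \<omega> * \<epsilon> j \<omega>))"
    unfolding sqL using int2
    by (subst Bochner_Integration.integral_sum, force, intro sum.cong refl,
        subst Bochner_Integration.integral_sum) auto
  also have "\<dots> = (\<Sum>i=1..N. \<Sum>j=1..N.
      error_cov M N \<epsilon> $$ (i - 1, j - 1) * w i * w j * fv i * fv j)"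
    by (intro sum.cong refl) (auto simp: error_cov_def mult_ac)
  finally have EL2: "expectation (\<lambda>\<omega>. (L \<omega>)\<^sup>2) = \<dots>" .
  show ?thesis
    unfolding slse_eq mean_eq using EL2 by (simp add: power_divide S_def)
qed

definition p_density :: "real \<Rightarrow> (real \<Rightarrow> real) \<Rightarrow> (real \<Rightarrow> real) \<Rightarrow> real \<Rightarrow> real" where
  "p_density lam f f'' t = - (1 / (2 * lam * f t)) * (f'' t - lam\<^sup>2 * f t)"

definition P_left :: "real \<Rightarrow> (real \<Rightarrow> real) \<Rightarrow> (real \<Rightarrow> real) \<Rightarrow> real \<Rightarrow> real" where
  "P_left lam f f' A = 1 / (2 * lam * f A) * (- f' A + lam * f A)"

definition P_right :: "real \<Rightarrow> (real \<Rightarrow> real) \<Rightarrow> (real \<Rightarrow> real) \<Rightarrow> real \<Rightarrow> real" where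
  "P_right lam f f' B = 1 / (2 * lam * f B) * (f' B + lam * f B)"

definition D_star ::
  "real \<Rightarrow> (real \<Rightarrow> real) \<Rightarrow> (real \<Rightarrow> real) \<Rightarrow> (real \<Rightarrow> real) \<Rightarrow> real \<Rightarrow> real \<Rightarrow> real" where
  "D_star lam f f' f'' A B =
     inverse (P_left lam f f' A * (f A)\<^sup>2 + P_right lam f f' B * (f B)\<^sup>2 +
       (LBINT t:{A..B}. p_density lam f f'' t * (f t)\<^sup>2))"

text \<open>The continuous signed least squares estimator, applied to a sample path \<open>y\<close>.\<close>

definition continuous_slse ::
  "real \<Rightarrow> (real \<Rightarrow> real) \<Rightarrow> (real \<Rightarrow> real) \<Rightarrow> (real \<Rightarrow> real) \<Rightarrow> real \<Rightarrow> real \<Rightarrow> (real \<Rightarrow> real) \<Rightarrow> real"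
  where
  "continuous_slse lam f f' f'' A B y =
     D_star lam f f' f'' A B *
       (P_left lam f f' A * f A * y A + P_right lam f f' B * f B * y B +
         (LBINT t:{A..B}. p_density lam f f'' t * f t * y t))"

text \<open>Joint measurability is what makes the path integral in \<^const>\<open>continuous_slse\<close> a random
  variable; the version with continuous paths has it. Gaussian means that every finite linear
  combination is normal, where the degenerate normal laws (point masses) are allowed.\<close>

definition continuous_ar1_process ::
  "'b measure \<Rightarrow> real \<Rightarrow> real \<Rightarrow> real \<Rightarrow> (real \<Rightarrow> 'b \<Rightarrow> real) \<Rightarrow> bool" where
  "continuous_ar1_process M lam A B \<epsilon> \<longleftrightarrow>
     prob_space M \<and>
     (\<lambda>(t, \<omega>). \<epsilon> t \<omega>) \<in> borel_measurable (restrict_space lborel {A..B} \<Otimes>\<^sub>M M) \<and>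
     (\<forall>T c. finite T \<and> T \<subseteq> {A..B} \<longrightarrow>
        (\<exists>m \<sigma>. \<sigma> > 0 \<and>
            distributed M lborel (\<lambda>\<omega>. \<Sum>t\<in>T. c t * \<epsilon> t \<omega>) (normal_density m \<sigma>)) \<or>
        (\<exists>m. AE \<omega> in M. (\<Sum>t\<in>T. c t * \<epsilon> t \<omega>) = m)) \<and>
     (\<forall>t\<in>{A..B}. prob_space.expectation M (\<epsilon> t) = 0) \<and>
     (\<forall>s\<in>{A..B}. \<forall>t\<in>{A..B}.
        prob_space.expectation M (\<lambda>\<omega>. \<epsilon> s \<omega> * \<epsilon> t \<omega>) = exp (- lam * \<bar>t - s\<bar>))"

end

theory Submission
  imports Defs "HOL-Real_Asymp.Real_Asymp" "Jordan_Normal_Form.Determinant"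
begin

text \<open>Let \<open>R\<close> be the bidiagonal matrix turning the errors into their independent innovations. Then
  \<open>R \<Sigma> R\<^sup>T\<close> is diagonal, so \<open>\<Sigma>\<^sup>-\<^sup>1 = R\<^sup>T D\<^sup>-\<^sup>1 R\<close> and the optimal weights give the variance
  \<open>1 / (f\<^sub>1\<^sup>2 + \<Sum>\<^sub>j (f\<^sub>j - a f\<^sub>j\<^sub>-\<^sub>1)\<^sup>2 / (1 - a\<^sup>2))\<close>. By the mean value theorem for \<open>e\<^sup>\<lambda>\<^sup>t f(t)\<close> the sum is,
  up to a factor tending to \<open>1 / (2\<lambda>)\<close>, a Riemann sum of \<open>(f' + \<lambda> f)\<^sup>2\<close>, and integration by parts
  identifies the limit with \<open>1 / D\<^sup>*\<close>.

  For the continuous estimator put \<open>X = P\<^sub>A f(A) \<epsilon>(A) + P\<^sub>B f(B) \<epsilon>(B) + \<integral> p f \<epsilon>\<close>. The measure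
  with atoms \<open>P\<^sub>A f(A)\<close>, \<open>P\<^sub>B f(B)\<close> and density \<open>p f\<close> is transformed into \<open>f\<close> by the kernel
  \<open>e\<^sup>-\<^sup>\<lambda>\<^sup>|\<^sup>s\<^sup>-\<^sup>t\<^sup>|\<close>, that is, \<open>E[X \<epsilon>(s)] = f(s)\<close>; a second application of Fubini gives
  \<open>E[X\<^sup>2] = 1 / D\<^sup>*\<close>.\<close>

subsection \<open>The variance of the optimal discrete design\<close>

lemma mat_inverse_eqI:
  fixes S T :: "'a :: field mat"
  assumes S: "S \<in> carrier_mat n n" and T: "T \<in> carrier_mat n n" and TS: "T * S = 1\<^sub>m n"
  shows "mat_inverse S = Some T"
proof -
  \<comment> \<open>For square matrices over a field a left inverse is also a right inverse. Hence
    \<open>S\<close> is a unit, which excludes the value \<open>None\<close>, and uniqueness of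
    inverses identifies the computed one with \<open>T\<close>.\<close>
  have ST: "S * T = 1\<^sub>m n"
    by (rule mat_mult_left_right_inverse[OF T S TS])
  show ?thesis
  proof (cases "mat_inverse S")
    case None
    have "S \<in> Units (ring_mat TYPE('a) n n)"
      using S T TS ST by (auto simp: Units_def ring_mat_simps)
    with mat_inverse(1)[OF S None, where b = n] show ?thesis by blast
  next
    case (Some U)
    then have U: "S * U = 1\<^sub>m n" "U \<in> carrier_mat n n"
      using mat_inverse(2)[OF S] by auto
    have "T = T * (S * U)" using T U by simp
    also have "\<dots> = (T * S) * U" using assoc_mult_mat[OF T S U(2)] by simp
    also have "\<dots> = U" using TS U by simp
    finally show ?thesis using Some by simp
  qed
qed

text \<open>Reading \<open>E * (R * S * R^T) = 1\<close> as \<open>(E * R * S) * R^T = 1\<close>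
  exhibits a one-sided inverse of \<open>R^T\<close>. Exchanging the two factors turns this into a
  left inverse of \<open>S\<close>, so no inverse of \<open>R\<close> has to be computed.\<close>

lemma mat_inverse_congruence:
  fixes S R D E :: "real mat"
  assumes S: "S \<in> carrier_mat n n" and R: "R \<in> carrier_mat n n"
    and D: "D \<in> carrier_mat n n" and E: "E \<in> carrier_mat n n"
    and RSR: "R * S * R\<^sup>T = D" and ED: "E * D = 1\<^sub>m n"
  shows "mat_inverse S = Some (R\<^sup>T * (E * R))"
proof (rule mat_inverse_eqI[OF S])
  have Rt: "R\<^sup>T \<in> carrier_mat n n" using R by simp
  have ER: "E * R \<in> carrier_mat n n" using E R by simp
  have ERS: "E * R * S \<in> carrier_mat n n" using ER S by simp
  show "R\<^sup>T * (E * R) \<in> carrier_mat n n" using Rt ER by (rule mult_carrier_mat)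
  have "(E * R * S) * R\<^sup>T = E * (R * S * R\<^sup>T)"
    using E R S Rt by (simp add: assoc_mult_mat[of _ n n _ n _ n])
  also have "\<dots> = 1\<^sub>m n" using RSR ED by simp
  finally have "R\<^sup>T * (E * R * S) = 1\<^sub>m n"
    by (rule mat_mult_left_right_inverse[OF ERS Rt])
  then show "R\<^sup>T * (E * R) * S = 1\<^sub>m n"
    using assoc_mult_mat[OF Rt ER S] by simp
qed

text \<open>Put \<open>v = S^-1 x\<close>. The weights satisfy \<open>w_i * fv_i = v_i\<close>, so
  the numerator is \<open>v . S v = x . v\<close> and the denominator is \<open>(x . v)^2\<close>.
  The identity survives \<open>x . v = 0\<close>, where both sides are \<open>0\<close>.\<close>

lemma optimal_weight_variance:
  fixes S T :: "real mat" and fv :: "nat \<Rightarrow> real"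
  assumes S: "S \<in> carrier_mat N N" and inv: "mat_inverse S = Some T"
    and nz: "\<And>i. i \<in> {1..N} \<Longrightarrow> fv i \<noteq> 0"
  defines "x \<equiv> vec N (\<lambda>k. fv (Suc k))" and "w \<equiv> optimal_weight N S fv"
  shows "(\<Sum>i=1..N. \<Sum>j=1..N. S $$ (i - 1, j - 1) * w i * w j * fv i * fv j) /
      (\<Sum>i=1..N. w i * (fv i)\<^sup>2)\<^sup>2 = inverse (x \<bullet> (T *\<^sub>v x))"
proof -
  have T: "S * T = 1\<^sub>m N" "T \<in> carrier_mat N N" using mat_inverse(2)[OF S inv] by auto
  have x: "x \<in> carrier_vec N" by (simp add: x_def)
  define v where "v = T *\<^sub>v x"
  have v: "v \<in> carrier_vec N" using T x by (simp add: v_def)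
  have wv: "w (Suc i) * fv (Suc i) = v $ i" if "i < N" for i
    using that nz[of "Suc i"] T inv scalar_prod_left_unit[OF v that]
    by (simp add: w_def optimal_weight_def v_def x_def)
  have Sv: "S *\<^sub>v v = x"
    unfolding v_def using assoc_mult_mat_vec[OF S T(2) x] T x by simp
  have "(\<Sum>i=1..N. w i * (fv i)\<^sup>2) = (\<Sum>i<N. x $ i * v $ i)"
    unfolding One_nat_def sum.atLeast1_atMost_eq
    by (intro sum.cong refl) (auto simp: x_def power2_eq_square mult.assoc[symmetric] wv)
  also have "\<dots> = x \<bullet> v" using v by (auto simp: scalar_prod_def lessThan_atLeast0)
  finally have den: "(\<Sum>i=1..N. w i * (fv i)\<^sup>2) = x \<bullet> v" .
  have "(\<Sum>i=1..N. \<Sum>j=1..N. S $$ (i - 1, j - 1) * w i * w j * fv i * fv j)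
      = (\<Sum>i<N. \<Sum>j<N. v $ i * (S $$ (i, j) * v $ j))"
    unfolding One_nat_def sum.atLeast1_atMost_eq
    by (intro sum.cong refl) (auto simp: wv[symmetric])
  also have "\<dots> = v \<bullet> (S *\<^sub>v v)"
    using S v by (auto simp: scalar_prod_def lessThan_atLeast0 sum_distrib_left intro!: sum.cong)
  also have "\<dots> = x \<bullet> v" using Sv comm_scalar_prod[OF v x] by simp
  finally show ?thesis
    unfolding den by (simp add: v_def power2_eq_square field_simps)
qed

text \<open>The whitening matrix \<open>R\<close> of the process: row \<open>0\<close> keeps the
  first error, and row \<open>i > 0\<close> produces
  \<open>\<epsilon> (i + 1) - a * \<epsilon> i\<close>, the innovation with index
  \<open>i + 1\<close>.\<close>

definition ar1_mat :: "nat \<Rightarrow> real \<Rightarrow> real mat" where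
  "ar1_mat n a = mat n n (\<lambda>(i, k). if k = i then 1 else if Suc k = i then - a else 0)"

lemma ar1_mat_carrier [simp]: "ar1_mat n a \<in> carrier_mat n n"
  by (simp add: ar1_mat_def)

lemma sum_ar1_mat_row:
  fixes g :: "nat \<Rightarrow> real"
  assumes "i < n"
  shows "(\<Sum>k<n. ar1_mat n a $$ (i, k) * g k) = g i - (if i = 0 then 0 else a * g (i - 1))"
proof -
  have "(\<Sum>k<n. ar1_mat n a $$ (i, k) * g k)
      = (\<Sum>k<n. (if k = i then g k else 0) + (if Suc k = i then - a * g k else 0))"
    using assms by (intro sum.cong) (auto simp: ar1_mat_def)
  also have "\<dots> = g i + (\<Sum>k<n. if Suc k = i then - a * g k else 0)"
    using assms by (simp add: sum.distrib)
  also have "(\<Sum>k<n. if Suc k = i then - a * g k else 0) = - (if i = 0 then 0 else a * g (i - 1))"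
    using assms by (cases i) auto
  finally show ?thesis by simp
qed

section \<open>Moments and covariances of the AR(1) errors\<close>

lemma (in prob_space) normal_distributed_second_moment:
  assumes "0 < \<sigma>" and D: "distributed M lborel X (normal_density 0 \<sigma>)"
  shows "expectation (\<lambda>\<omega>. (X \<omega>)\<^sup>2) = \<sigma>\<^sup>2" and "integrable M (\<lambda>\<omega>. (X \<omega>)\<^sup>2)"
proof -
  show E: "expectation (\<lambda>\<omega>. (X \<omega>)\<^sup>2) = \<sigma>\<^sup>2"
    using normal_distributed_variance[OF assms] normal_distributed_expectation[OF assms] by simp
  show "integrable M (\<lambda>\<omega>. (X \<omega>)\<^sup>2)"
    \<comment> \<open>A non-integrable function has Bochner integral \<open>0\<close>, which
      contradicts the positive value in \<open>E\<close>.\<close>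
    by (rule ccontr) (use E assms(1) not_integrable_integral_eq in fastforce)
qed

text \<open>The integrable majorant is \<open>X^2 + Y^2\<close>, by
  \<open>2 * |X| * |Y| \<le> X^2 + Y^2\<close>.\<close>

lemma integrable_mult_of_squares:
  fixes X Y :: "'a \<Rightarrow> real"
  assumes [measurable]: "X \<in> borel_measurable M" "Y \<in> borel_measurable M"
    and "integrable M (\<lambda>\<omega>. (X \<omega>)\<^sup>2)" "integrable M (\<lambda>\<omega>. (Y \<omega>)\<^sup>2)"
  shows "integrable M (\<lambda>\<omega>. X \<omega> * Y \<omega>)"
proof (rule Bochner_Integration.integrable_bound)
  show "integrable M (\<lambda>\<omega>. (X \<omega>)\<^sup>2 + (Y \<omega>)\<^sup>2)" using assms by auto
  have "\<bar>X \<omega>\<bar> * \<bar>Y \<omega>\<bar> \<le> (X \<omega>)\<^sup>2 + (Y \<omega>)\<^sup>2" for \<omega>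
    using sum_squares_bound[of "\<bar>X \<omega>\<bar>" "\<bar>Y \<omega>\<bar>"] mult_nonneg_nonneg[of "\<bar>X \<omega>\<bar>" "\<bar>Y \<omega>\<bar>"]
    unfolding power2_abs by linarith
  then show "AE \<omega> in M. norm (X \<omega> * Y \<omega>) \<le> norm ((X \<omega>)\<^sup>2 + (Y \<omega>)\<^sup>2)"
    by (simp add: abs_mult)
qed simp

lemma integrable_square_add:
  fixes X Y :: "'a \<Rightarrow> real"
  assumes "X \<in> borel_measurable M" "Y \<in> borel_measurable M"
    and "integrable M (\<lambda>\<omega>. (X \<omega>)\<^sup>2)" "integrable M (\<lambda>\<omega>. (Y \<omega>)\<^sup>2)"
  shows "integrable M (\<lambda>\<omega>. (X \<omega> + Y \<omega>)\<^sup>2)"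
  unfolding power2_sum using assms integrable_mult_of_squares[OF assms]
  by (auto simp: mult.assoc)

text \<open>\<open>u\<close> is the independent centred family that drives the recursion. Distinct
  members are uncorrelated because the expectation of their product factors; the diagonal values are
  the variances.\<close>

lemma ar1_errors_innovations:
  assumes ar: "ar1_errors M N a \<epsilon> z" and a: "\<bar>a\<bar> < 1"
  defines "u \<equiv> \<lambda>j. if j = 1 then \<epsilon> 1 else z j"
  shows "\<And>i. i \<in> {1..N} \<Longrightarrow> u i \<in> borel_measurable M"
    and "\<And>i. i \<in> {1..N} \<Longrightarrow> integrable M (\<lambda>\<omega>. (u i \<omega>)\<^sup>2)"
    and "\<And>i. i \<in> {1..N} \<Longrightarrow> prob_space.expectation M (u i) = 0"
    and "\<And>i j. i \<in> {1..N} \<Longrightarrow> j \<in> {1..N} \<Longrightarrow>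
      prob_space.expectation M (\<lambda>\<omega>. u i \<omega> * u j \<omega>) =
        (if i = j then if i = 1 then 1 else 1 - a\<^sup>2 else 0)"
proof -
  interpret prob_space M using ar by (simp add: ar1_errors_def)
  define \<sigma> where "\<sigma> i = (if i = 1 then 1 else sqrt (1 - a\<^sup>2))" for i :: nat
  have a2: "a\<^sup>2 < 1" using a by (simp add: abs_square_less_1)
  have \<sigma>: "\<sigma> i > 0" for i using a2 by (simp add: \<sigma>_def)
  have D: "distributed M lborel (u i) (normal_density 0 (\<sigma> i))" if "i \<in> {1..N}" for i
  proof (cases "i = 1")
    case True
    then show ?thesis using ar by (simp add: ar1_errors_def u_def \<sigma>_def)
  next
    case False
    then have "i \<in> {2..N}" using that by auto
    then show ?thesis using ar False by (simp add: ar1_errors_def u_def \<sigma>_def)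
  qed
  have indep: "indep_vars (\<lambda>_. borel) u {1..N}" using ar by (simp add: ar1_errors_def u_def)
  show meas: "u i \<in> borel_measurable M" if "i \<in> {1..N}" for i
    using distributed_measurable[OF D[OF that]] by simp
  show sq: "integrable M (\<lambda>\<omega>. (u i \<omega>)\<^sup>2)" if "i \<in> {1..N}" for i
    by (rule normal_distributed_second_moment(2)[OF \<sigma> D[OF that]])
  show mean: "expectation (u i) = 0" if "i \<in> {1..N}" for i
    by (rule normal_distributed_expectation[OF \<sigma> D[OF that]])
  fix i j assume ij: "i \<in> {1..N}" "j \<in> {1..N}"
  show "expectation (\<lambda>\<omega>. u i \<omega> * u j \<omega>) = (if i = j then if i = 1 then 1 else 1 - a\<^sup>2 else 0)"
  proof (cases "i = j")
    case True
    then show ?thesis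
      using normal_distributed_second_moment(1)[OF \<sigma> D[OF ij(1)]] a2
      by (auto simp: power2_eq_square[symmetric] \<sigma>_def)
  next
    case False
    have "indep_vars (\<lambda>_. borel) u {i, j}" using indep ij by (auto intro: indep_vars_subset)
    then have "expectation (\<lambda>\<omega>. \<Prod>k\<in>{i, j}. u k \<omega>) = (\<Prod>k\<in>{i, j}. expectation (u k))"
      using square_integrable_imp_integrable[OF meas sq] ij
      by (intro indep_vars_lebesgue_integral) auto
    then show ?thesis using False mean ij by simp
  qed
qed

text \<open>Induction along \<open>\<epsilon> (i + 1) = a * \<epsilon> i + z (i + 1)\<close>:
  centred square integrable variables are closed under sums. The recursion holds only on
  \<open>space M\<close>, so each property is transferred by a congruence rule.\<close>

lemma ar1_errors_moments:
  assumes ar: "ar1_errors M N a \<epsilon> z" and a: "\<bar>a\<bar> < 1" and i: "i \<in> {1..N}"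
  shows "\<epsilon> i \<in> borel_measurable M" and "integrable M (\<lambda>\<omega>. (\<epsilon> i \<omega>)\<^sup>2)"
    and "prob_space.expectation M (\<epsilon> i) = 0"
proof -
  interpret prob_space M using ar by (simp add: ar1_errors_def)
  note inn = ar1_errors_innovations[OF ar a]
  have "\<epsilon> i \<in> borel_measurable M \<and> integrable M (\<lambda>\<omega>. (\<epsilon> i \<omega>)\<^sup>2) \<and> expectation (\<epsilon> i) = 0"
    using i
  proof (induction i)
    case 0
    then show ?case by simp
  next
    case (Suc i)
    show ?case
    proof (cases "i = 0")
      case True
      then show ?thesis using inn(1-3)[of 1] Suc.prems by simp
    next
      case False
      then have IH: "\<epsilon> i \<in> borel_measurable M" "integrable M (\<lambda>\<omega>. (\<epsilon> i \<omega>)\<^sup>2)" "expectation (\<epsilon> i) = 0"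
        using Suc by auto
      define Y where "Y = (\<lambda>\<omega>. a * \<epsilon> i \<omega>)"
      have Y: "Y \<in> borel_measurable M" "integrable M (\<lambda>\<omega>. (Y \<omega>)\<^sup>2)" "expectation Y = 0"
        using IH by (auto simp: Y_def power_mult_distrib)
      have z: "z (Suc i) \<in> borel_measurable M" "integrable M (\<lambda>\<omega>. (z (Suc i) \<omega>)\<^sup>2)"
          "expectation (z (Suc i)) = 0"
        using inn(1-3)[of "Suc i"] Suc.prems False by auto
      have eq: "\<epsilon> (Suc i) \<omega> = Y \<omega> + z (Suc i) \<omega>" if "\<omega> \<in> space M" for \<omega>
      proof -
        have "Suc i \<in> {2..N}" using False Suc.prems by auto
        then have "\<epsilon> (Suc i) \<omega> - a * \<epsilon> (Suc i - 1) \<omega> = z (Suc i) \<omega>"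
          using ar that unfolding ar1_errors_def by blast
        then show ?thesis by (simp add: Y_def)
      qed
      have "\<epsilon> (Suc i) \<in> borel_measurable M \<longleftrightarrow> (\<lambda>\<omega>. Y \<omega> + z (Suc i) \<omega>) \<in> borel_measurable M"
        by (intro measurable_cong eq)
      moreover have "integrable M (\<lambda>\<omega>. (\<epsilon> (Suc i) \<omega>)\<^sup>2) \<longleftrightarrow>
          integrable M (\<lambda>\<omega>. (Y \<omega> + z (Suc i) \<omega>)\<^sup>2)"
        by (intro Bochner_Integration.integrable_cong) (auto simp: eq)
      moreover have "expectation (\<epsilon> (Suc i)) = expectation (\<lambda>\<omega>. Y \<omega> + z (Suc i) \<omega>)"
        by (intro Bochner_Integration.integral_cong) (auto simp: eq)
      moreover have "expectation (\<lambda>\<omega>. Y \<omega> + z (Suc i) \<omega>) = 0"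
        using Y z square_integrable_imp_integrable by (subst Bochner_Integration.integral_add) auto
      ultimately show ?thesis
        using Y(1) z(1) integrable_square_add[OF Y(1) z(1) Y(2) z(2)] by simp
    qed
  qed
  then show "\<epsilon> i \<in> borel_measurable M" and "integrable M (\<lambda>\<omega>. (\<epsilon> i \<omega>)\<^sup>2)"
    and "prob_space.expectation M (\<epsilon> i) = 0" by auto
qed

text \<open>By bilinearity, entry \<open>(i, j)\<close> is the expectation of the product of
  components \<open>i\<close> and \<open>j\<close> of \<open>R\<close> applied to the errors. These
  components are innovations, whose covariances are known, so the entries \<open>a^|i-j|\<close>
  need not be computed.\<close>

lemma ar1_mat_error_cov:
  assumes ar: "ar1_errors M N a \<epsilon> z" and a: "\<bar>a\<bar> < 1"
  shows "ar1_mat N a * error_cov M N \<epsilon> * (ar1_mat N a)\<^sup>T =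
    mat N N (\<lambda>(i, j). if i = j then if i = 0 then 1 else 1 - a\<^sup>2 else 0)"
    (is "?R * ?S * _ = ?D")
proof (rule eq_matI)
  interpret prob_space M using ar by (simp add: ar1_errors_def)
  define u where "u j = (if j = 1 then \<epsilon> 1 else z j)" for j
  note inn = ar1_errors_innovations[OF ar a, folded u_def]
  note mom = ar1_errors_moments[OF ar a]
  have Re: "(\<Sum>k<N. ?R $$ (i, k) * \<epsilon> (Suc k) \<omega>) = u (Suc i) \<omega>" if "i < N" "\<omega> \<in> space M" for i \<omega>
  proof (cases "i = 0")
    case False
    then have "Suc i \<in> {2..N}" using that by auto
    then have "\<epsilon> (Suc i) \<omega> - a * \<epsilon> (Suc i - 1) \<omega> = z (Suc i) \<omega>"
      using ar that unfolding ar1_errors_def by blast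
    then show ?thesis using False that by (simp add: sum_ar1_mat_row u_def)
  qed (use that in \<open>simp add: sum_ar1_mat_row u_def\<close>)
  fix i j assume "i < dim_row ?D" "j < dim_col ?D"
  then have ij: "i < N" "j < N" by auto
  have int: "integrable M (\<lambda>\<omega>. \<epsilon> (Suc k) \<omega> * \<epsilon> (Suc l) \<omega>)" if "k < N" "l < N" for k l
    using mom[of "Suc k"] mom[of "Suc l"] that by (intro integrable_mult_of_squares) auto
  have "(?R * ?S * ?R\<^sup>T) $$ (i, j) = (\<Sum>l<N. (\<Sum>k<N. ?R $$ (i, k) * ?S $$ (k, l)) * ?R $$ (j, l))"
    using ij by (simp add: scalar_prod_def lessThan_atLeast0 error_cov_def ar1_mat_def)
  also have "\<dots> = (\<Sum>l<N. \<Sum>k<N. ?R $$ (i, k) * ?R $$ (j, l) *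
      expectation (\<lambda>\<omega>. \<epsilon> (Suc k) \<omega> * \<epsilon> (Suc l) \<omega>))"
    unfolding sum_distrib_right by (intro sum.cong refl) (auto simp: error_cov_def mult_ac)
  also have "\<dots> = expectation (\<lambda>\<omega>. \<Sum>l<N. \<Sum>k<N. ?R $$ (i, k) * ?R $$ (j, l) *
      (\<epsilon> (Suc k) \<omega> * \<epsilon> (Suc l) \<omega>))"
    using int
    by (subst Bochner_Integration.integral_sum, force, intro sum.cong refl,
        subst Bochner_Integration.integral_sum) auto
  also have "\<dots> = expectation (\<lambda>\<omega>. (\<Sum>k<N. ?R $$ (i, k) * \<epsilon> (Suc k) \<omega>) *
      (\<Sum>l<N. ?R $$ (j, l) * \<epsilon> (Suc l) \<omega>))"
    unfolding sum_product by (subst sum.swap) (simp add: mult_ac)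
  also have "\<dots> = expectation (\<lambda>\<omega>. u (Suc i) \<omega> * u (Suc j) \<omega>)"
    by (intro Bochner_Integration.integral_cong) (simp_all add: Re ij)
  also have "\<dots> = ?D $$ (i, j)" using inn(4)[of "Suc i" "Suc j"] ij by simp
  finally show "(?R * ?S * ?R\<^sup>T) $$ (i, j) = ?D $$ (i, j)" .
qed (simp_all add: ar1_mat_def)

text \<open>Since the inverse covariance is \<open>R^T E R\<close> with \<open>E\<close> diagonal,
  the quadratic form at \<open>x\<close> is the sum of \<open>y_i^2 / d_i\<close> for the whitened
  regression vector \<open>y = R x\<close>.\<close>

lemma variance_optimal_slse:
  assumes ar: "ar1_errors M N a \<epsilon> z" and a: "\<bar>a\<bar> < 1" and N: "1 \<le> N"
    and nz: "\<And>i. i \<in> {1..N} \<Longrightarrow> fv i \<noteq> 0"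
  shows "prob_space.variance M
      (\<lambda>\<omega>. slse N (optimal_weight N (error_cov M N \<epsilon>) fv) fv (\<lambda>j. \<theta> * fv j + \<epsilon> j \<omega>)) =
    inverse ((fv 1)\<^sup>2 + (\<Sum>j=2..N. (fv j - a * fv (j - 1))\<^sup>2) / (1 - a\<^sup>2))"
proof -
  interpret prob_space M using ar by (simp add: ar1_errors_def)
  note mom = ar1_errors_moments[OF ar a]
  have a2: "1 - a\<^sup>2 \<noteq> 0" using a abs_square_less_1[of a] by simp
  define R where "R = ar1_mat N a"
  define S where "S = error_cov M N \<epsilon>"
  define d where "d i = (if i = 0 then 1 else 1 - a\<^sup>2)" for i :: nat
  have d: "d i \<noteq> 0" for i using a2 by (simp add: d_def)
  define D where "D = mat N N (\<lambda>(i, j). if i = j then d i else 0)"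
  define E where "E = mat N N (\<lambda>(i, j). if i = j then inverse (d i) else 0)"
  have carr: "S \<in> carrier_mat N N" "R \<in> carrier_mat N N" "D \<in> carrier_mat N N" "E \<in> carrier_mat N N"
    by (simp_all add: S_def R_def D_def E_def error_cov_def)
  have RSR: "R * S * R\<^sup>T = D"
    using ar1_mat_error_cov[OF ar a] by (simp add: R_def S_def D_def d_def cong: if_cong)
  have "E * D = 1\<^sub>m N"
    by (rule eq_matI) (auto simp: E_def D_def scalar_prod_def d if_distrib[of "\<lambda>x. x * _"]
        if_distrib[of "\<lambda>x. _ * x"] sum.delta cong: if_cong)
  then have inv: "mat_inverse S = Some (R\<^sup>T * (E * R))"
    by (rule mat_inverse_congruence[OF carr RSR])
  define x where "x = vec N (\<lambda>k. fv (Suc k))"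
  have x: "x \<in> carrier_vec N" by (simp add: x_def)
  define y where "y = R *\<^sub>v x"
  have y: "y \<in> carrier_vec N" using carr x by (simp add: y_def)
  have yi: "y $ i = fv (Suc i) - (if i = 0 then 0 else a * fv i)" if "i < N" for i
  proof -
    have "y $ i = (\<Sum>k<N. R $$ (i, k) * fv (Suc k))"
      using that carr by (simp add: y_def x_def scalar_prod_def lessThan_atLeast0)
    then show ?thesis using that by (simp add: R_def sum_ar1_mat_row)
  qed
  have "x \<bullet> ((R\<^sup>T * (E * R)) *\<^sub>v x) = x \<bullet> (R\<^sup>T *\<^sub>v (E *\<^sub>v y))"
    using carr x by (simp add: y_def assoc_mult_mat_vec[of _ N N _ N])
  also have "\<dots> = y \<bullet> (E *\<^sub>v y)"
  proof -
    have Ey: "E *\<^sub>v y \<in> carrier_vec N" using carr y by simp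
    have "x \<bullet> (R\<^sup>T *\<^sub>v (E *\<^sub>v y)) = (R\<^sup>T *\<^sub>v (E *\<^sub>v y)) \<bullet> x"
      using carr x Ey by (intro comm_scalar_prod[of _ N]) auto
    also have "\<dots> = (E *\<^sub>v y) \<bullet> y"
      unfolding y_def[symmetric] using transpose_vec_mult_scalar[OF carr(2) x Ey] by (simp add: y_def)
    also have "\<dots> = y \<bullet> (E *\<^sub>v y)" by (rule comm_scalar_prod[OF Ey y])
    finally show ?thesis .
  qed
  also have "\<dots> = (\<Sum>i<N. (y $ i)\<^sup>2 / d i)"
  proof -
    have "(E *\<^sub>v y) $ i = y $ i / d i" if "i < N" for i
      using that y by (auto simp: E_def scalar_prod_def if_distrib[of "\<lambda>x. x * _"] sum.delta
          divide_inverse cong: if_cong)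
    moreover have "dim_vec (E *\<^sub>v y) = N" by (simp add: E_def)
    ultimately show ?thesis
      by (simp add: scalar_prod_def lessThan_atLeast0 power2_eq_square)
  qed
  also have "\<dots> = (fv 1)\<^sup>2 + (\<Sum>j=2..N. (fv j - a * fv (j - 1))\<^sup>2) / (1 - a\<^sup>2)"
  proof -
    have "(\<Sum>i<N. (y $ i)\<^sup>2 / d i) = (\<Sum>j=1..N. (y $ (j - 1))\<^sup>2 / d (j - 1))"
      unfolding One_nat_def sum.atLeast1_atMost_eq by simp
    also have "\<dots> = (y $ 0)\<^sup>2 / d 0 + (\<Sum>j=2..N. (y $ (j - 1))\<^sup>2 / d (j - 1))"
      using N by (simp add: sum.atLeast_Suc_atMost numeral_2_eq_2)
    also have "(\<Sum>j=2..N. (y $ (j - 1))\<^sup>2 / d (j - 1)) =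
        (\<Sum>j=2..N. (fv j - a * fv (j - 1))\<^sup>2 / (1 - a\<^sup>2))"
      by (intro sum.cong refl) (auto simp: yi d_def)
    finally show ?thesis using N by (simp add: yi d_def sum_divide_distrib)
  qed
  finally have q: "x \<bullet> ((R\<^sup>T * (E * R)) *\<^sub>v x) = \<dots>" .
  show ?thesis
    using variance_slse[OF prob_space_axioms mom] optimal_weight_variance[OF carr(1) inv nz]
    by (simp add: q x_def[symmetric] S_def[symmetric])
qed

subsection \<open>Riemann sums over the design points\<close>

text \<open>A form with derivatives relative to \<open>X\<close>, hence one-sided at end points of
  an interval; taking \<open>\<xi>\<close> from the closed interval also covers
  \<open>a = b\<close>.\<close>

lemma mvt_within:
  fixes F F' :: "real \<Rightarrow> real"
  assumes "a \<le> b" "{a..b} \<subseteq> X"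
    and F: "\<And>t. t \<in> X \<Longrightarrow> (F has_real_derivative F' t) (at t within X)"
  obtains \<xi> where "\<xi> \<in> {a..b}" "F b - F a = F' \<xi> * (b - a)"
proof -
  have "\<exists>x\<in>{a..b}. F b - F a = (*) (F' x) (b - a)"
    using assms(1,2)
    by (intro mvt_very_simple)
      (auto intro!: has_field_derivative_imp_has_derivative DERIV_subset[OF F])
  then show ?thesis using that by auto
qed

context
  fixes A B :: real
  assumes AB: "A < B"
begin

lemma design_step_pos: "2 \<le> N \<Longrightarrow> 0 < design_step A B N"
  using AB by (simp add: design_step_def)

lemma design_step_total: "2 \<le> N \<Longrightarrow> (real N - 1) * design_step A B N = B - A"
  by (simp add: design_step_def)

lemma design_step_tendsto: "filterlim (design_step A B) (at_right 0) sequentially"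
  unfolding design_step_def[abs_def] using AB by real_asymp

lemma design_pt_first: "design_pt A B N 1 = A"
  by (simp add: design_pt_def)

lemma design_pt_last: "2 \<le> N \<Longrightarrow> design_pt A B N N = B"
  by (simp add: design_pt_def design_step_total)

lemma design_pt_diff:
  "1 \<le> j \<Longrightarrow> design_pt A B N j - design_pt A B N (j - 1) = design_step A B N"
  by (simp add: design_pt_def of_nat_diff algebra_simps)

lemma design_pt_mem:
  assumes "2 \<le> N" "j \<in> {1..N}"
  shows "design_pt A B N j \<in> {A..B}"
proof -
  have "0 \<le> (real j - 1) * design_step A B N"
    using assms design_step_pos[of N] by auto
  moreover have "(real j - 1) * design_step A B N \<le> (real N - 1) * design_step A B N"
    using assms design_step_pos[of N] by (intro mult_right_mono) auto
  ultimately show ?thesis using design_step_total[OF assms(1)] by (simp add: design_pt_def)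
qed

lemma design_interval_subset:
  assumes "2 \<le> N" "j \<in> {2..N}"
  shows "{design_pt A B N (j - 1)..design_pt A B N j} \<subseteq> {A..B}"
proof -
  have "j \<in> {1..N}" "j - 1 \<in> {1..N}" using assms(2) by auto
  then show ?thesis using design_pt_mem[OF assms(1)] by fastforce
qed

text \<open>The increments of \<open>H\<close> over the cells telescope to \<open>H B - H A\<close>,
  and each is \<open>\<Delta> * h \<eta>\<close> by the mean value theorem. Uniform continuity of
  \<open>h\<close> makes it harmless to replace \<open>\<eta>\<close> by another point of the same
  cell.\<close>

lemma riemann_sum_tendsto:
  fixes H h :: "real \<Rightarrow> real"
  assumes H: "\<And>t. t \<in> {A..B} \<Longrightarrow> (H has_real_derivative h t) (at t within {A..B})"
    and h: "continuous_on {A..B} h"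
    and \<xi>: "\<And>N j. 2 \<le> N \<Longrightarrow> j \<in> {2..N} \<Longrightarrow>
      \<xi> N j \<in> {design_pt A B N (j - 1)..design_pt A B N j}"
  shows "(\<lambda>N. \<Sum>j=2..N. design_step A B N * h (\<xi> N j)) \<longlonglongrightarrow> H B - H A"
proof (rule LIMSEQ_I)
  fix r :: real assume r: "0 < r"
  \<comment> \<open>There are \<open>N - 1\<close> cells with error at most
    \<open>\<Delta> * e\<close> each; in total this is \<open>(B - A) * e = r / 2\<close>.\<close>
  define e where "e = r / (2 * (B - A))"
  have e: "e > 0" "(B - A) * e < r" using r AB by (auto simp: e_def field_simps)
  obtain d where d: "d > 0" "\<And>x y. x \<in> {A..B} \<Longrightarrow> y \<in> {A..B} \<Longrightarrow> dist y x < d \<Longrightarrow> dist (h y) (h x) < e"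
    using compact_uniformly_continuous[OF h] e(1) unfolding uniformly_continuous_on_def
    by (metis compact_Icc)
  have "(\<lambda>N. design_step A B N) \<longlonglongrightarrow> 0"
    using design_step_tendsto by (simp add: filterlim_at)
  then have "eventually (\<lambda>N. design_step A B N < d) sequentially"
    using d(1) order_tendstoD(2) by blast
  then obtain N0 where N0: "\<And>N. N \<ge> N0 \<Longrightarrow> design_step A B N < d"
    by (auto simp: eventually_sequentially)
  show "\<exists>no. \<forall>N\<ge>no. norm ((\<Sum>j=2..N. design_step A B N * h (\<xi> N j)) - (H B - H A)) < r"
  proof (intro exI allI impI)
    fix N assume "max 2 N0 \<le> N"
    then have N: "2 \<le> N" "design_step A B N < d" using N0 by auto
    define \<Delta> where "\<Delta> = design_step A B N"
    define t where "t j = design_pt A B N j" for j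
    have tele: "H B - H A = (\<Sum>j=2..N. H (t j) - H (t (j - 1)))"
      using sum_telescope''[of 1 N "\<lambda>j. H (t j)"] N design_pt_first design_pt_last
      by (simp add: t_def numeral_2_eq_2)
    have bound: "norm (\<Delta> * h (\<xi> N j) - (H (t j) - H (t (j - 1)))) \<le> \<Delta> * e"
      if j: "j \<in> {2..N}" for j
    proof -
      have diff: "t j - t (j - 1) = \<Delta>"
        using j design_pt_diff[of j N] by (simp add: t_def \<Delta>_def)
      have sub: "{t (j - 1)..t j} \<subseteq> {A..B}"
        using design_interval_subset[OF N(1) j] by (simp add: t_def)
      have \<Delta>: "\<Delta> > 0" using design_step_pos[OF N(1)] by (simp add: \<Delta>_def)
      have le: "t (j - 1) \<le> t j" using diff \<Delta> by linarith
      obtain \<eta> where \<eta>: "\<eta> \<in> {t (j - 1)..t j}" "H (t j) - H (t (j - 1)) = h \<eta> * \<Delta>"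
        using mvt_within[OF le sub H] diff by auto
      have \<xi>j: "\<xi> N j \<in> {t (j - 1)..t j}" using \<xi>[OF N(1) j] by (simp add: t_def)
      have "dist (\<xi> N j) \<eta> \<le> \<Delta>" using \<xi>j \<eta>(1) diff by (auto simp: dist_real_def)
      then have "dist (\<xi> N j) \<eta> < d" using N(2) by (simp add: \<Delta>_def)
      then have "dist (h (\<xi> N j)) (h \<eta>) < e"
        using sub \<xi>j \<eta>(1) by (intro d(2)) auto
      then have "\<Delta> * \<bar>h (\<xi> N j) - h \<eta>\<bar> \<le> \<Delta> * e"
        using \<Delta> by (intro mult_left_mono) (auto simp: dist_real_def)
      moreover have "\<Delta> * h (\<xi> N j) - h \<eta> * \<Delta> = \<Delta> * (h (\<xi> N j) - h \<eta>)"
        by (simp add: algebra_simps)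
      ultimately show ?thesis using \<Delta> \<eta>(2) by (simp add: abs_mult)
    qed
    have "norm ((\<Sum>j=2..N. \<Delta> * h (\<xi> N j)) - (H B - H A))
        = norm (\<Sum>j=2..N. \<Delta> * h (\<xi> N j) - (H (t j) - H (t (j - 1))))"
      unfolding tele by (simp only: sum_subtractf)
    also have "\<dots> \<le> (\<Sum>j=2..N. \<Delta> * e)"
      by (rule sum_norm_le) (rule bound)
    also have "\<dots> = ((real N - 1) * \<Delta>) * e"
      using N(1) by (simp add: of_nat_diff)
    also have "\<dots> = (B - A) * e"
      using design_step_total[OF N(1)] by (simp add: \<Delta>_def)
    finally show "norm ((\<Sum>j=2..N. design_step A B N * h (\<xi> N j)) - (H B - H A)) < r"
      using e(2) by (simp add: \<Delta>_def)
  qed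
qed

text \<open>The mean value theorem is applied to \<open>exp (lam * t) * f t\<close>, with derivative
  \<open>exp (lam * t) * (f' t + lam * f t)\<close>. Multiplying by \<open>exp (- lam * t)\<close>
  leaves the factor \<open>exp (- lam * (t - \<xi>))\<close>, whose square is
  \<open>c\<close>.\<close>

lemma ar1_increment_mvt:
  fixes f f' :: "real \<Rightarrow> real"
  assumes lam: "0 < lam" and f: "\<And>t. t \<in> X \<Longrightarrow> (f has_real_derivative f' t) (at t within X)"
    and st: "s \<le> t" "{s..t} \<subseteq> X"
  obtains \<xi> c where "\<xi> \<in> {s..t}" "(exp (- lam * (t - s)))\<^sup>2 \<le> c" "c \<le> 1"
    "(f t - exp (- lam * (t - s)) * f s)\<^sup>2 = c * ((t - s)\<^sup>2 * (f' \<xi> + lam * f \<xi>)\<^sup>2)"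
proof -
  have "((\<lambda>t. exp (lam * t) * f t) has_real_derivative exp (lam * t) * (f' t + lam * f t)) (at t within X)"
    if "t \<in> X" for t
    by (rule derivative_eq_intros f that refl | simp add: algebra_simps)+
  from mvt_within[OF st this] obtain \<xi> where \<xi>: "\<xi> \<in> {s..t}"
    "exp (lam * t) * f t - exp (lam * s) * f s = exp (lam * \<xi>) * (f' \<xi> + lam * f \<xi>) * (t - s)"
    by auto
  have "f t - exp (- lam * (t - s)) * f s = exp (- lam * t) * (exp (lam * t) * f t - exp (lam * s) * f s)"
    by (simp add: algebra_simps flip: exp_add)
  also have "\<dots> = exp (- lam * (t - \<xi>)) * ((t - s) * (f' \<xi> + lam * f \<xi>))"
    unfolding \<xi>(2) by (simp add: algebra_simps flip: exp_add)
  finally have eq: "f t - exp (- lam * (t - s)) * f s = \<dots>" .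
  show ?thesis
  proof (rule that[of \<xi> "(exp (- lam * (t - \<xi>)))\<^sup>2"])
    show "(exp (- lam * (t - s)))\<^sup>2 \<le> (exp (- lam * (t - \<xi>)))\<^sup>2"
      using \<xi>(1) lam by (intro power_mono) auto
    show "(exp (- lam * (t - \<xi>)))\<^sup>2 \<le> 1"
      using \<xi>(1) lam by (intro power_le_one) auto
    show "(f t - exp (- lam * (t - s)) * f s)\<^sup>2 =
        (exp (- lam * (t - \<xi>)))\<^sup>2 * ((t - s)\<^sup>2 * (f' \<xi> + lam * f \<xi>)\<^sup>2)"
      unfolding eq power_mult_distrib ..
  qed (rule \<xi>)
qed

text \<open>The quotient is split as \<open>(sum / \<Delta>) * (\<Delta> / (1 - a^2))\<close>. The
  first factor lies between \<open>a^2\<close> times a Riemann sum of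
  \<open>(f' + lam * f)^2\<close> and that sum itself, and \<open>a^2\<close> tends to
  \<open>1\<close>. The second tends to \<open>1 / (2 * lam)\<close> because
  \<open>1 - exp (- 2 * lam * x)\<close> behaves like \<open>2 * lam * x\<close> near
  \<open>0\<close>.\<close>

lemma ar1_increments_tendsto:
  fixes f f' H :: "real \<Rightarrow> real" and lam :: real
  defines "a \<equiv> \<lambda>N. exp (- lam * design_step A B N)"
  assumes lam: "0 < lam"
    and f: "\<And>t. t \<in> {A..B} \<Longrightarrow> (f has_real_derivative f' t) (at t within {A..B})"
    and f': "continuous_on {A..B} f'"
    and H: "\<And>t. t \<in> {A..B} \<Longrightarrow> (H has_real_derivative (f' t + lam * f t)\<^sup>2) (at t within {A..B})"
  shows "(\<lambda>N. (\<Sum>j=2..N. (f (design_pt A B N j) - a N * f (design_pt A B N (j - 1)))\<^sup>2) / (1 - (a N)\<^sup>2))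
    \<longlonglongrightarrow> (H B - H A) / (2 * lam)"
proof -
  let ?\<Delta> = "design_step A B" and ?t = "design_pt A B"
  define h where "h t = (f' t + lam * f t)\<^sup>2" for t
  define s where "s N j = (f (?t N j) - a N * f (?t N (j - 1)))\<^sup>2" for N j
  have contf: "continuous_on {A..B} f"
    by (rule DERIV_continuous_on[OF f])
  have h: "continuous_on {A..B} h" unfolding h_def by (intro continuous_intros contf f')
  \<comment> \<open>The same tag serves both bounds. The side conditions stand inside the
    existential so that a choice function exists on all \<open>N\<close> and
    \<open>j\<close>.\<close>
  have "\<exists>\<xi>. 2 \<le> N \<longrightarrow> j \<in> {2..N} \<longrightarrow> \<xi> \<in> {?t N (j - 1)..?t N j} \<and>
      (a N)\<^sup>2 * (?\<Delta> N * h \<xi>) \<le> s N j / ?\<Delta> N \<and> s N j / ?\<Delta> N \<le> ?\<Delta> N * h \<xi>" for N j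
  proof (cases "2 \<le> N \<and> j \<in> {2..N}")
    case True
    then have N: "2 \<le> N" and j: "j \<in> {2..N}" by auto
    have \<Delta>: "?\<Delta> N > 0" by (rule design_step_pos[OF N])
    have diff: "?t N j - ?t N (j - 1) = ?\<Delta> N" using design_pt_diff[of j N] j by simp
    have le: "?t N (j - 1) \<le> ?t N j" using diff \<Delta> by linarith
    obtain \<xi> c where \<xi>: "\<xi> \<in> {?t N (j - 1)..?t N j}" "(a N)\<^sup>2 \<le> c" "c \<le> 1"
      "s N j = c * ((?\<Delta> N)\<^sup>2 * h \<xi>)"
      unfolding a_def s_def h_def
      by (rule ar1_increment_mvt[OF lam f le design_interval_subset[OF N j], unfolded diff])
    have "s N j / ?\<Delta> N = c * (?\<Delta> N * h \<xi>)" using \<Delta> \<xi>(4) by (simp add: power2_eq_square)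
    moreover have "0 \<le> ?\<Delta> N * h \<xi>" using \<Delta> by (simp add: h_def)
    moreover have "0 \<le> c" using \<xi>(2) by (rule order_trans[OF zero_le_power2])
    ultimately show ?thesis
      using \<xi> by (auto intro!: exI[of _ \<xi>] mult_right_mono mult_left_le_one_le)
  qed auto
  then obtain \<xi> where \<xi>: "\<And>N j. 2 \<le> N \<Longrightarrow> j \<in> {2..N} \<Longrightarrow> \<xi> N j \<in> {?t N (j - 1)..?t N j} \<and>
      (a N)\<^sup>2 * (?\<Delta> N * h (\<xi> N j)) \<le> s N j / ?\<Delta> N \<and> s N j / ?\<Delta> N \<le> ?\<Delta> N * h (\<xi> N j)"
    by metis
  define R where "R N = (\<Sum>j=2..N. ?\<Delta> N * h (\<xi> N j))" for N
  have R: "R \<longlonglongrightarrow> H B - H A"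
    unfolding R_def using riemann_sum_tendsto[OF H[folded h_def] h, of \<xi>] \<xi> by simp
  have step0: "?\<Delta> \<longlonglongrightarrow> 0"
    using design_step_tendsto by (simp add: filterlim_at)
  have a: "(\<lambda>N. (a N)\<^sup>2) \<longlonglongrightarrow> 1"
    unfolding a_def by (rule tendsto_eq_intros step0 refl | simp)+
  have "(\<lambda>N. (\<Sum>j=2..N. s N j) / ?\<Delta> N) \<longlonglongrightarrow> H B - H A"
  proof (rule tendsto_sandwich)
    show "(\<lambda>N. (a N)\<^sup>2 * R N) \<longlonglongrightarrow> H B - H A"
      using tendsto_mult[OF a R] by simp
    show "\<forall>\<^sub>F N in sequentially. (a N)\<^sup>2 * R N \<le> (\<Sum>j=2..N. s N j) / ?\<Delta> N"
      using eventually_ge_at_top[of 2]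
    proof eventually_elim
      case (elim N)
      show ?case
        unfolding R_def sum_distrib_left sum_divide_distrib
        by (rule sum_mono) (simp only: \<xi>[OF elim])
    qed
    show "\<forall>\<^sub>F N in sequentially. (\<Sum>j=2..N. s N j) / ?\<Delta> N \<le> R N"
      using eventually_ge_at_top[of 2]
    proof eventually_elim
      case (elim N)
      show ?case
        unfolding R_def sum_divide_distrib
        by (rule sum_mono) (simp only: \<xi>[OF elim])
    qed
  qed (rule R)
  moreover have "(\<lambda>N. ?\<Delta> N / (1 - (a N)\<^sup>2)) \<longlonglongrightarrow> 1 / (2 * lam)"
  proof -
    have "((\<lambda>x. x / (1 - (exp (- lam * x))\<^sup>2)) \<longlongrightarrow> inverse lam / 2) (at_right 0)"
      using lam by real_asymp
    from filterlim_compose[OF this design_step_tendsto] have "(\<lambda>N. ?\<Delta> N / (1 - (a N)\<^sup>2)) \<longlonglongrightarrow> inverse lam / 2"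
      unfolding a_def .
    moreover have "inverse lam / 2 = 1 / (2 * lam)" using lam by (simp add: field_simps)
    ultimately show ?thesis by simp
  qed
  ultimately have "(\<lambda>N. (\<Sum>j=2..N. s N j) / ?\<Delta> N * (?\<Delta> N / (1 - (a N)\<^sup>2))) \<longlonglongrightarrow>
      (H B - H A) * (1 / (2 * lam))"
    by (rule tendsto_mult)
  \<comment> \<open>Cancelling the step needs it to be nonzero: it is positive from
    \<open>N = 2\<close> on but \<open>0\<close> at \<open>N = 1\<close>, where its denominator
    vanishes.\<close>
  moreover have "\<forall>\<^sub>F N in sequentially. (\<Sum>j=2..N. s N j) / ?\<Delta> N * (?\<Delta> N / (1 - (a N)\<^sup>2)) =
      (\<Sum>j=2..N. s N j) / (1 - (a N)\<^sup>2)"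
    using eventually_ge_at_top[of 2]
  proof eventually_elim
    case (elim N)
    then show ?case using design_step_pos[OF elim] by simp
  qed
  ultimately have "(\<lambda>N. (\<Sum>j=2..N. s N j) / (1 - (a N)\<^sup>2)) \<longlonglongrightarrow> (H B - H A) * (1 / (2 * lam))"
    by (rule Lim_transform_eventually)
  then show ?thesis by (simp add: s_def)
qed

end

subsection \<open>Path integrals of second-order processes\<close>

text \<open>A frame for exchanging expectation and integration along a path: second moments bounded
  over a finite measure make the process square integrable on the product space. The intended
  instance is Lebesgue measure on \<open>[A, B]\<close> with the process
  \<open>g t * \<epsilon> t\<close>.\<close>

locale second_order_process = prob_space M + T: finite_measure L
  for L :: "'t measure" and M :: "'a measure" +
  fixes e :: "'t \<Rightarrow> 'a \<Rightarrow> real" and C :: real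
  assumes meas [measurable]: "(\<lambda>(t, \<omega>). e t \<omega>) \<in> borel_measurable (L \<Otimes>\<^sub>M M)"
    and square_integrable: "\<And>t. t \<in> space L \<Longrightarrow> integrable M (\<lambda>\<omega>. (e t \<omega>)\<^sup>2)"
    and square_bound: "\<And>t. t \<in> space L \<Longrightarrow> expectation (\<lambda>\<omega>. (e t \<omega>)\<^sup>2) \<le> C"
begin

sublocale P: pair_sigma_finite L M ..

lemma square_integrable_pair: "integrable (L \<Otimes>\<^sub>M M) (\<lambda>(t, \<omega>). (e t \<omega>)\<^sup>2)"
proof (rule P.Fubini_integrable)
  show "(\<lambda>(t, \<omega>). (e t \<omega>)\<^sup>2) \<in> borel_measurable (L \<Otimes>\<^sub>M M)" by measurable
  have "integrable L (\<lambda>t. \<integral>\<omega>. (e t \<omega>)\<^sup>2 \<partial>M)"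
    by (rule T.integrable_const_bound[where B = C]) (auto intro!: AE_I2 square_bound)
  then show "integrable L (\<lambda>t. \<integral>\<omega>. norm (case (t, \<omega>) of (t, \<omega>) \<Rightarrow> (e t \<omega>)\<^sup>2) \<partial>M)" by simp
  show "AE t in L. integrable M (\<lambda>\<omega>. case (t, \<omega>) of (t, \<omega>) \<Rightarrow> (e t \<omega>)\<^sup>2)"
    by (auto intro: square_integrable)
qed

text \<open>Viewed as a function constant in \<open>t\<close>, \<open>Y\<close> is square integrable
  on the product because \<open>L\<close> is finite; the product of two square integrable functions
  is integrable.\<close>

lemma integrable_pair_mult:
  assumes Y [measurable]: "Y \<in> borel_measurable M" and Y2: "integrable M (\<lambda>\<omega>. (Y \<omega>)\<^sup>2)"
  shows "integrable (L \<Otimes>\<^sub>M M) (\<lambda>(t, \<omega>). e t \<omega> * Y \<omega>)"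
proof -
  have "integrable (L \<Otimes>\<^sub>M M) (\<lambda>(t, \<omega>). (Y \<omega>)\<^sup>2)"
    by (rule P.Fubini_integrable) (auto simp: Y2)
  then have "integrable (L \<Otimes>\<^sub>M M) (\<lambda>p. e (fst p) (snd p) * Y (snd p))"
    using square_integrable_pair
    by (intro integrable_mult_of_squares)  (auto simp: split_beta')
  then show ?thesis by (simp add: split_beta')
qed

text \<open>Paths that are not integrable receive the default value \<open>0\<close>; they form a
  null set.\<close>

definition path_integral :: "'a \<Rightarrow> real" where
  "path_integral \<omega> = (\<integral>t. e t \<omega> \<partial>L)"

lemma path_integral_measurable [measurable]: "path_integral \<in> borel_measurable M"
  unfolding path_integral_def[abs_def] by measurable

lemma AE_path_integrable: "AE \<omega> in M. integrable L (\<lambda>t. e t \<omega>)"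
  using P.AE_integrable_snd[OF integrable_pair_mult[of "\<lambda>_. 1"]] by simp

lemma expectation_path_integral_mult:
  assumes "Y \<in> borel_measurable M" "integrable M (\<lambda>\<omega>. (Y \<omega>)\<^sup>2)"
  shows "expectation (\<lambda>\<omega>. path_integral \<omega> * Y \<omega>) = (\<integral>t. expectation (\<lambda>\<omega>. e t \<omega> * Y \<omega>) \<partial>L)"
  using P.Fubini_integral[OF integrable_pair_mult[OF assms]] by (simp add: path_integral_def)

text \<open>Cauchy-Schwarz on almost every path bounds the square by the total mass of
  \<open>L\<close> times the integral of the squared path, and the latter is integrable by
  Fubini.\<close>

lemma path_integral_square_integrable: "integrable M (\<lambda>\<omega>. (path_integral \<omega>)\<^sup>2)"
proof (rule Bochner_Integration.integrable_bound)
  let ?V = "measure L (space L)" and ?Q = "\<lambda>\<omega>. \<integral>t. (e t \<omega>)\<^sup>2 \<partial>L"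
  show "integrable M (\<lambda>\<omega>. ?V * ?Q \<omega>)"
    using P.integrable_snd[OF square_integrable_pair] by simp
  have "AE \<omega> in M. (path_integral \<omega>)\<^sup>2 \<le> ?V * ?Q \<omega>"
    using AE_path_integrable P.AE_integrable_snd[OF square_integrable_pair]
  proof eventually_elim
    case (elim \<omega>)
    define I where "I = path_integral \<omega>"
    show ?case
    proof (cases "?V = 0")
      case True
      then have "AE t in L. False"
        by (intro AE_I[of _ _ "space L"]) (auto simp: T.emeasure_eq_measure)
      then have "I = 0" unfolding I_def path_integral_def
        by (intro integral_eq_zero_AE) auto
      then show ?thesis using True by (simp add: I_def)
    next
      case False
      then have V: "?V > 0" by (simp add: zero_less_measure_iff)
      \<comment> \<open>Expanding this square proves Cauchy-Schwarz up to a factor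
        \<open>?V\<close>, which is why mass zero is a separate case.\<close>
      have "0 \<le> (\<integral>t. (?V * e t \<omega> - I)\<^sup>2 \<partial>L)" by simp
      also have "\<dots> = (\<integral>t. ?V\<^sup>2 * (e t \<omega>)\<^sup>2 + I\<^sup>2 - 2 * ?V * I * e t \<omega> \<partial>L)"
        by (intro Bochner_Integration.integral_cong refl) (simp add: power2_eq_square algebra_simps)
      also have "\<dots> = ?V\<^sup>2 * ?Q \<omega> + ?V * I\<^sup>2 - 2 * ?V * I * I"
        using elim by (simp add: I_def path_integral_def)
      also have "\<dots> = ?V * (?V * ?Q \<omega> - I\<^sup>2)" by (simp add: power2_eq_square algebra_simps)
      finally show ?thesis using V by (simp add: zero_le_mult_iff I_def)
    qed
  qed
  then show "AE \<omega> in M. norm ((path_integral \<omega>)\<^sup>2) \<le> norm (?V * ?Q \<omega>)"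
    by eventually_elim auto
qed simp

end

subsection \<open>The limiting information and the continuous estimator\<close>

locale ar1_regression =
  fixes A B lam :: real and f f' f'' :: "real \<Rightarrow> real"
  assumes AB: "A < B" and lam: "0 < lam"
    and f: "\<And>t. t \<in> {A..B} \<Longrightarrow> (f has_real_derivative f' t) (at t within {A..B})"
    and f': "\<And>t. t \<in> {A..B} \<Longrightarrow> (f' has_real_derivative f'' t) (at t within {A..B})"
    and f'': "continuous_on {A..B} f''"
    and nz: "\<And>t. t \<in> {A..B} \<Longrightarrow> f t \<noteq> 0"
begin

lemma cont_f: "continuous_on {A..B} f" and cont_f': "continuous_on {A..B} f'"
  by (rule DERIV_continuous_on, erule f f')+

text \<open>\<open>g\<close>, \<open>gA\<close> and \<open>gB\<close> are \<open>p f\<close>,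
  \<open>P_A f(A)\<close> and \<open>P_B f(B)\<close> with \<open>f\<close> cancelled from the
  denominators: the density and the atoms of the signed measure against which the estimator
  integrates a path, up to the factor \<open>D_star\<close>.\<close>

definition g :: "real \<Rightarrow> real" where "g t = (lam\<^sup>2 * f t - f'' t) / (2 * lam)"
definition gA :: real where "gA = (lam * f A - f' A) / (2 * lam)"
definition gB :: real where "gB = (lam * f B + f' B) / (2 * lam)"
text \<open>The reciprocal of \<open>D_star\<close>. It arises twice: as the limit of the reciprocal
  discrete variances and as the second moment of the unnormalised error of the continuous
  estimator.\<close>

definition info :: real where "info = gA * f A + gB * f B + (LBINT t:{A..B}. g t * f t)"

lemma p_density_mult: "t \<in> {A..B} \<Longrightarrow> p_density lam f f'' t * f t = g t"
  using nz lam by (simp add: p_density_def g_def field_simps)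

lemma P_left_mult: "P_left lam f f' A * f A = gA"
  using nz[of A] lam AB by (simp add: P_left_def gA_def field_simps)

lemma P_right_mult: "P_right lam f f' B * f B = gB"
  using nz[of B] lam AB by (simp add: P_right_def gB_def field_simps)

lemma cont_g: "continuous_on {A..B} g"
  unfolding g_def using lam by (intro continuous_intros cont_f f'') auto

lemma D_star_eq: "D_star lam f f' f'' A B = inverse info"
proof -
  have "(LBINT t:{A..B}. p_density lam f f'' t * (f t)\<^sup>2) = (LBINT t:{A..B}. g t * f t)"
    by (intro set_lebesgue_integral_cong)
      (auto simp: power2_eq_square p_density_mult simp flip: mult.assoc)
  then show ?thesis
    unfolding D_star_def info_def P_left_mult[symmetric] P_right_mult[symmetric]
    by (simp add: power2_eq_square mult.assoc)
qed

section \<open>Integration by parts: the limiting information and the kernel transform\<close>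

lemma LBINT_eq_integral:
  fixes h :: "real \<Rightarrow> real"
  assumes "continuous_on {A..B} h"
  shows "(LBINT t:{A..B}. h t) = integral {A..B} h"
  using assms by (intro set_borel_integral_eq_integral borel_integrable_atLeastAtMost')

text \<open>A primitive of \<open>(f' + lam * f)^2\<close>, read off from \<open>(f' + lam * f)^2 =
  2 * lam * g * f + (f * f')' + lam * (f^2)'\<close>. The first summand brings in the integrand of
  \<open>info\<close>, the others its boundary terms.\<close>

definition H :: "real \<Rightarrow> real" where
  "H t = 2 * lam * integral {A..t} (\<lambda>t. g t * f t) + f t * f' t + lam * (f t)\<^sup>2"

lemma H_deriv:
  assumes "t \<in> {A..B}"
  shows "(H has_real_derivative (f' t + lam * f t)\<^sup>2) (at t within {A..B})"
proof -
  have "continuous_on {A..B} (\<lambda>t. g t * f t)" by (intro continuous_intros cont_g cont_f)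
  note D = integral_has_real_derivative[OF this assms]
  show ?thesis
    unfolding H_def[abs_def]
    by (rule derivative_eq_intros D f[OF assms] f'[OF assms] refl)+
      (use lam in \<open>simp add: g_def field_simps power2_eq_square\<close>)
qed

text \<open>The boundary part of \<open>H B / (2 * lam)\<close> is \<open>gB * f B\<close>, and
  \<open>(f A)^2\<close> minus that of \<open>H A / (2 * lam)\<close> is
  \<open>gA * f A\<close>.\<close>

lemma info_eq: "(f A)\<^sup>2 + (H B - H A) / (2 * lam) = info"
  using lam
  by (simp add: info_def H_def gA_def gB_def LBINT_eq_integral continuous_intros cont_g cont_f
      field_simps power2_eq_square)

text \<open>The derivative of \<open>H\<close> is a square, so \<open>info\<close> is at least
  \<open>(f A)^2\<close>. This allows passing to the limit under \<open>inverse\<close> and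
  cancelling \<open>info\<close>.\<close>

lemma info_pos: "info > 0"
proof -
  obtain \<xi> where "H B - H A = (f' \<xi> + lam * f \<xi>)\<^sup>2 * (B - A)"
    by (rule mvt_within[of A B "{A..B}" H]) (use AB H_deriv in auto)
  then have "(H B - H A) / (2 * lam) \<ge> 0" using AB lam by simp
  moreover have "(f A)\<^sup>2 > 0" using nz[of A] AB by simp
  ultimately show ?thesis unfolding info_eq[symmetric] by linarith
qed

lemma discrete_variance_tendsto:
  assumes ar: "\<And>N. N \<ge> 2 \<Longrightarrow> ar1_errors (M N) N (exp (- lam * design_step A B N)) (\<epsilon> N) (z N)"
  shows "(\<lambda>N. prob_space.variance (M N)
            (\<lambda>\<omega>. slse N
               (optimal_weight N (error_cov (M N) N (\<epsilon> N)) (\<lambda>j. f (design_pt A B N j)))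
               (\<lambda>j. f (design_pt A B N j))
               (\<lambda>j. \<theta> * f (design_pt A B N j) + \<epsilon> N j \<omega>)))
          \<longlonglongrightarrow> inverse info"
proof -
  define a where "a N = exp (- lam * design_step A B N)" for N
  let ?t = "design_pt A B"
  have "(\<lambda>N. inverse ((f A)\<^sup>2 + (\<Sum>j=2..N. (f (?t N j) - a N * f (?t N (j - 1)))\<^sup>2) / (1 - (a N)\<^sup>2)))
      \<longlonglongrightarrow> inverse ((f A)\<^sup>2 + (H B - H A) / (2 * lam))"
    unfolding a_def using info_pos info_eq
    by (intro tendsto_inverse tendsto_add tendsto_const
        ar1_increments_tendsto[OF AB lam f cont_f' H_deriv]) auto
  moreover have "\<forall>\<^sub>F N in sequentially. inverse ((f A)\<^sup>2 +
        (\<Sum>j=2..N. (f (?t N j) - a N * f (?t N (j - 1)))\<^sup>2) / (1 - (a N)\<^sup>2)) =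
      prob_space.variance (M N) (\<lambda>\<omega>. slse N
               (optimal_weight N (error_cov (M N) N (\<epsilon> N)) (\<lambda>j. f (?t N j)))
               (\<lambda>j. f (?t N j)) (\<lambda>j. \<theta> * f (?t N j) + \<epsilon> N j \<omega>))"
    using eventually_ge_at_top[of 2]
  proof eventually_elim
    case (elim N)
    have "\<bar>a N\<bar> < 1" using design_step_pos[OF AB elim] lam by (simp add: a_def)
    moreover have "f (?t N j) \<noteq> 0" if "j \<in> {1..N}" for j
      using design_pt_mem[OF AB elim that] by (rule nz)
    ultimately show ?case
      using variance_optimal_slse[OF ar[OF elim, folded a_def], of "\<lambda>j. f (?t N j)"] elim
      by (simp add: design_pt_first[OF AB, unfolded One_nat_def])
  qed
  ultimately show ?thesis unfolding info_eq by (rule Lim_transform_eventually)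
qed

text \<open>The function \<open>exp (- lam * |s - t|) / (2 * lam)\<close> is the Green function of
  \<open>lam^2 - d^2/dt^2\<close> on the line, and \<open>g\<close> is this operator applied to
  \<open>f\<close>, divided by \<open>2 * lam\<close>. On an interval boundary terms remain at
  \<open>A\<close> and \<open>B\<close>; the two atoms cancel them.\<close>

lemma kernel_identity:
  assumes s: "s \<in> {A..B}"
  shows "gA * exp (- lam * \<bar>s - A\<bar>) + gB * exp (- lam * \<bar>s - B\<bar>) +
    (LBINT t:{A..B}. g t * exp (- lam * \<bar>s - t\<bar>)) = f s"
proof -
  let ?k = "\<lambda>t. g t * exp (- lam * \<bar>s - t\<bar>)"
  \<comment> \<open>\<open>F1\<close> and \<open>F2\<close> are primitives of the integrand to the
    left and to the right of \<open>s\<close>. Their jump \<open>F1 s - F2 s\<close> is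
    \<open>f s\<close>, while \<open>F1 A\<close> and \<open>- F2 B\<close> are the contributions of
    the atoms.\<close>
  define F1 where "F1 t = (lam * f t - f' t) / (2 * lam) * exp (- lam * (s - t))" for t
  define F2 where "F2 t = - ((lam * f t + f' t) / (2 * lam) * exp (- lam * (t - s)))" for t
  have d1: "(F1 has_real_derivative ?k t) (at t within {A..s})" if "t \<in> {A..s}" for t
  proof -
    have "t \<in> {A..B}" using that s by auto
    note D = DERIV_subset[OF f[OF this], of "{A..s}"] DERIV_subset[OF f'[OF this], of "{A..s}"]
    show ?thesis
      unfolding F1_def[abs_def]
      by (rule derivative_eq_intros D refl | use s lam in force)+
        (use that lam in \<open>simp add: g_def field_simps power2_eq_square\<close>)
  qed
  have d2: "(F2 has_real_derivative ?k t) (at t within {s..B})" if "t \<in> {s..B}" for t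
  proof -
    have "t \<in> {A..B}" using that s by auto
    note D = DERIV_subset[OF f[OF this], of "{s..B}"] DERIV_subset[OF f'[OF this], of "{s..B}"]
    show ?thesis
      unfolding F2_def[abs_def]
      by (rule derivative_eq_intros D refl | use s lam in force)+
        (use that lam in \<open>simp add: g_def field_simps power2_eq_square\<close>)
  qed
  have "(?k has_integral (F1 s - F1 A)) {A..s}" "(?k has_integral (F2 B - F2 s)) {s..B}"
    using s d1 d2
    by (auto intro!: fundamental_theorem_of_calculus
        simp flip: has_real_derivative_iff_has_vector_derivative)
  then have "(?k has_integral ((F1 s - F1 A) + (F2 B - F2 s))) {A..B}"
    using s by (intro has_integral_combine[of A s B]) auto
  moreover have "continuous_on {A..B} ?k" by (intro continuous_intros cont_g)
  ultimately have "(LBINT t:{A..B}. ?k t) = (F1 s - F1 A) + (F2 B - F2 s)"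
    using LBINT_eq_integral by (simp add: integral_unique)
  moreover have "F1 s - F2 s = f s" using lam by (simp add: F1_def F2_def field_simps)
  moreover have "F1 A = gA * exp (- lam * \<bar>s - A\<bar>)" using s by (simp add: F1_def gA_def)
  moreover have "F2 B = - (gB * exp (- lam * \<bar>s - B\<bar>))"
    using s by (simp add: F2_def gB_def)
  ultimately show ?thesis by linarith
qed

section \<open>Variance of the continuous estimator\<close>

lemma continuous_slse_eq:
  "continuous_slse lam f f' f'' A B y =
    inverse info * (gA * y A + gB * y B + (LBINT t:{A..B}. g t * y t))"
proof -
  have "(LBINT t:{A..B}. p_density lam f f'' t * f t * y t) = (LBINT t:{A..B}. g t * y t)"
    by (intro set_lebesgue_integral_cong) (auto simp: p_density_mult)
  then show ?thesis
    by (simp add: continuous_slse_def D_star_eq P_left_mult P_right_mult)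
qed

text \<open>Almost surely the estimator is \<open>\<theta> + X / info\<close> with \<open>X\<close>
  centred. The kernel identity gives \<open>E[X \<epsilon>(s)] = f s\<close>, integrating this once
  more gives \<open>E[X^2] = info\<close>, and so the variance is
  \<open>info / info^2\<close>.\<close>

lemma continuous_variance:
  assumes pr: "continuous_ar1_process M lam A B \<epsilon>"
  shows "prob_space.variance M (\<lambda>\<omega>. continuous_slse lam f f' f'' A B (\<lambda>t. \<theta> * f t + \<epsilon> t \<omega>)) =
    inverse info"
proof -
  interpret prob_space M using pr by (simp add: continuous_ar1_process_def)
  define L where "L = restrict_space lborel {A..B}"
  have space_L: "space L = {A..B}" by (simp add: L_def space_restrict_space)
  have integral_L: "(\<integral>t. h t \<partial>L) = (LBINT t:{A..B}. h t)" for h :: "real \<Rightarrow> real"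
    by (simp add: L_def integral_restrict_space set_lebesgue_integral_def)
  have L_meas: "h \<in> borel_measurable L" if "continuous_on {A..B} h" for h :: "real \<Rightarrow> real"
    using borel_measurable_continuous_on_restrict[OF that]
    by (simp add: L_def cong: measurable_cong_sets restrict_space_sets_cong)
  have [measurable]: "g \<in> borel_measurable L" "f \<in> borel_measurable L"
    by (auto intro: L_meas cont_g cont_f)
  have mean: "expectation (\<epsilon> t) = 0" if "t \<in> {A..B}" for t
    using pr that by (simp add: continuous_ar1_process_def)
  have cov: "expectation (\<lambda>\<omega>. \<epsilon> s \<omega> * \<epsilon> t \<omega>) = exp (- lam * \<bar>t - s\<bar>)"
    if "s \<in> {A..B}" "t \<in> {A..B}" for s t
    using pr that by (simp add: continuous_ar1_process_def)
  have joint [measurable]: "(\<lambda>(t, \<omega>). \<epsilon> t \<omega>) \<in> borel_measurable (L \<Otimes>\<^sub>M M)"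
    using pr by (simp add: continuous_ar1_process_def L_def)
  have meas_\<epsilon>: "\<epsilon> t \<in> borel_measurable M" if "t \<in> {A..B}" for t
    using measurable_Pair2[OF joint] that by (simp add: space_L)
  \<comment> \<open>The covariance formula at \<open>s = t\<close> has the value \<open>1\<close>; a
    non-integrable square would give \<open>0\<close>.\<close>
  have sq_\<epsilon>: "integrable M (\<lambda>\<omega>. (\<epsilon> t \<omega>)\<^sup>2)" if "t \<in> {A..B}" for t
    by (rule ccontr) (use cov[OF that that] not_integrable_integral_eq in
        \<open>fastforce simp: power2_eq_square\<close>)
  obtain K where K: "\<And>t. t \<in> {A..B} \<Longrightarrow> \<bar>g t\<bar> \<le> K"
    using compact_imp_bounded[OF compact_continuous_image[OF cont_g compact_Icc]]
    by (fastforce simp: bounded_iff)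
  interpret T: finite_measure L
    by (rule finite_measureI) (use AB in \<open>simp add: L_def emeasure_restrict_space space_restrict_space\<close>)
  \<comment> \<open>The weight \<open>g\<close> is absorbed into the process. As \<epsilon> has unit
    variance and \<open>|g| \<le> K\<close>, the second moments are at most
    \<open>K^2\<close>.\<close>
  interpret second_order_process L M "\<lambda>t \<omega>. g t * \<epsilon> t \<omega>" "K\<^sup>2"
  proof
    show "(\<lambda>(t, \<omega>). g t * \<epsilon> t \<omega>) \<in> borel_measurable (L \<Otimes>\<^sub>M M)" by measurable
    fix t assume "t \<in> space L"
    then have t: "t \<in> {A..B}" by (simp add: space_L)
    show "integrable M (\<lambda>\<omega>. (g t * \<epsilon> t \<omega>)\<^sup>2)" using sq_\<epsilon>[OF t] by (simp add: power_mult_distrib)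
    have "(g t)\<^sup>2 \<le> K\<^sup>2" using K[OF t] by (simp add: abs_le_square_iff[symmetric])
    moreover have "expectation (\<lambda>\<omega>. (\<epsilon> t \<omega>)\<^sup>2) = 1"
      using cov[OF t t] by (simp add: power2_eq_square)
    ultimately show "expectation (\<lambda>\<omega>. (g t * \<epsilon> t \<omega>)\<^sup>2) \<le> K\<^sup>2"
      by (simp add: power_mult_distrib)
  qed
  have ends: "A \<in> {A..B}" "B \<in> {A..B}" using AB by auto
  note [measurable] = meas_\<epsilon>[OF ends(1)] meas_\<epsilon>[OF ends(2)]
  define X where "X \<omega> = gA * \<epsilon> A \<omega> + gB * \<epsilon> B \<omega> + path_integral \<omega>" for \<omega>
  have X_meas [measurable]: "X \<in> borel_measurable M" unfolding X_def[abs_def] by measurable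
  have X_sq: "integrable M (\<lambda>\<omega>. (X \<omega>)\<^sup>2)"
    unfolding X_def using sq_\<epsilon> ends path_integral_square_integrable
    by (intro integrable_square_add) (auto simp: power_mult_distrib)
  \<comment> \<open>A general \<open>Y\<close> is kept because three choices follow:
    \<open>\<epsilon> s\<close>, then \<open>X\<close> itself, and the constant \<open>1\<close> for
    the mean.\<close>
  have X_mult: "expectation (\<lambda>\<omega>. X \<omega> * Y \<omega>) =
      gA * expectation (\<lambda>\<omega>. \<epsilon> A \<omega> * Y \<omega>) + gB * expectation (\<lambda>\<omega>. \<epsilon> B \<omega> * Y \<omega>) +
      (LBINT t:{A..B}. g t * expectation (\<lambda>\<omega>. \<epsilon> t \<omega> * Y \<omega>))"
    if Y: "Y \<in> borel_measurable M" "integrable M (\<lambda>\<omega>. (Y \<omega>)\<^sup>2)" for Y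
  proof -
    have "expectation (\<lambda>\<omega>. X \<omega> * Y \<omega>) =
        expectation (\<lambda>\<omega>. gA * (\<epsilon> A \<omega> * Y \<omega>) + gB * (\<epsilon> B \<omega> * Y \<omega>) + path_integral \<omega> * Y \<omega>)"
      by (simp add: X_def algebra_simps)
    also have "\<dots> = gA * expectation (\<lambda>\<omega>. \<epsilon> A \<omega> * Y \<omega>) + gB * expectation (\<lambda>\<omega>. \<epsilon> B \<omega> * Y \<omega>) +
        expectation (\<lambda>\<omega>. path_integral \<omega> * Y \<omega>)"
      using integrable_mult_of_squares[OF meas_\<epsilon>[OF ends(1)] Y(1) sq_\<epsilon>[OF ends(1)] Y(2)]
        integrable_mult_of_squares[OF meas_\<epsilon>[OF ends(2)] Y(1) sq_\<epsilon>[OF ends(2)] Y(2)]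
        integrable_mult_of_squares[OF path_integral_measurable Y(1) path_integral_square_integrable Y(2)]
      by simp
    also have "expectation (\<lambda>\<omega>. path_integral \<omega> * Y \<omega>) =
        (LBINT t:{A..B}. g t * expectation (\<lambda>\<omega>. \<epsilon> t \<omega> * Y \<omega>))"
      unfolding expectation_path_integral_mult[OF Y] integral_L by (simp add: mult.assoc)
    finally show ?thesis .
  qed
  have X\<epsilon>: "expectation (\<lambda>\<omega>. \<epsilon> s \<omega> * X \<omega>) = f s" if s: "s \<in> {A..B}" for s
  proof -
    have "(LBINT t:{A..B}. g t * expectation (\<lambda>\<omega>. \<epsilon> t \<omega> * \<epsilon> s \<omega>)) =
        (LBINT t:{A..B}. g t * exp (- lam * \<bar>s - t\<bar>))"
      by (intro set_lebesgue_integral_cong) (use cov s in auto)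
    then show ?thesis
      using X_mult[OF meas_\<epsilon>[OF s] sq_\<epsilon>[OF s]] kernel_identity[OF s] cov[OF _ s] ends
      by (simp add: mult.commute)
  qed
  have "(LBINT t:{A..B}. g t * expectation (\<lambda>\<omega>. \<epsilon> t \<omega> * X \<omega>)) = (LBINT t:{A..B}. g t * f t)"
    by (intro set_lebesgue_integral_cong) (use X\<epsilon> in auto)
  then have EX2: "expectation (\<lambda>\<omega>. (X \<omega>)\<^sup>2) = info"
    using X_mult[OF X_meas X_sq] X\<epsilon> ends by (simp add: power2_eq_square info_def)
  have "(LBINT t:{A..B}. g t * expectation (\<lambda>\<omega>. \<epsilon> t \<omega> * 1)) = (LBINT t:{A..B}. 0)"
    by (intro set_lebesgue_integral_cong) (use mean in auto)
  then have EX: "expectation X = 0"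
    using X_mult[of "\<lambda>_. 1"] mean ends by simp
  define V where "V \<omega> = continuous_slse lam f f' f'' A B (\<lambda>t. \<theta> * f t + \<epsilon> t \<omega>)" for \<omega>
  have V_eq: "V \<omega> = inverse info * (gA * (\<theta> * f A + \<epsilon> A \<omega>) + gB * (\<theta> * f B + \<epsilon> B \<omega>) +
      (\<integral>t. g t * (\<theta> * f t + \<epsilon> t \<omega>) \<partial>L))" for \<omega>
    by (simp add: V_def continuous_slse_eq integral_L)
  have V_meas [measurable]: "V \<in> borel_measurable M"
    unfolding V_eq[abs_def] by measurable
  have int_gf: "integrable L (\<lambda>t. g t * f t)"
  proof -
    have "continuous_on {A..B} (\<lambda>t. g t * f t)" by (intro continuous_intros cont_g cont_f)
    then have "set_integrable lborel {A..B} (\<lambda>t. g t * f t)"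
      by (rule borel_integrable_atLeastAtMost')
    then show ?thesis by (simp add: L_def integrable_restrict_space set_integrable_def)
  qed
  \<comment> \<open>Splitting the path integral requires an integrable path, hence the restriction
    to almost every \<open>\<omega>\<close>. The deterministic part contributes
    \<open>\<theta> * info\<close>, which the normalisation reduces to
    \<open>\<theta>\<close>.\<close>
  have AE_V: "AE \<omega> in M. V \<omega> = \<theta> + inverse info * X \<omega>"
    using AE_path_integrable
  proof eventually_elim
    case (elim \<omega>)
    have "(\<integral>t. g t * (\<theta> * f t + \<epsilon> t \<omega>) \<partial>L) = (\<integral>t. \<theta> * (g t * f t) + g t * \<epsilon> t \<omega> \<partial>L)"
      by (simp add: algebra_simps)
    also have "\<dots> = \<theta> * (\<integral>t. g t * f t \<partial>L) + path_integral \<omega>"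
      using int_gf elim by (simp add: path_integral_def)
    finally have "V \<omega> = inverse info * (\<theta> * info + X \<omega>)"
      unfolding V_eq by (simp add: info_def X_def integral_L algebra_simps)
    then show ?case using info_pos by (simp add: field_simps)
  qed
  have "expectation V = expectation (\<lambda>\<omega>. \<theta> + inverse info * X \<omega>)"
    by (intro integral_cong_AE AE_V) auto
  also have "\<dots> = \<theta>"
    using square_integrable_imp_integrable[OF X_meas X_sq] EX by (simp add: prob_space)
  finally have EV: "expectation V = \<theta>" .
  have "variance V = expectation (\<lambda>\<omega>. (inverse info)\<^sup>2 * (X \<omega>)\<^sup>2)"
    unfolding EV by (intro integral_cong_AE) (use AE_V in \<open>auto simp: power_mult_distrib\<close>)
  also have "\<dots> = inverse info"
    using EX2 info_pos by (simp add: power2_eq_square)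
  finally show ?thesis unfolding V_def[abs_def] .
qed

end

theorem proposition3p1:
  fixes A B lam \<theta> :: real and f f' f'' :: "real \<Rightarrow> real"
    and M :: "nat \<Rightarrow> 'a measure" and \<epsilon> z :: "nat \<Rightarrow> nat \<Rightarrow> 'a \<Rightarrow> real"
    and Mc :: "'b measure" and \<epsilon>c :: "real \<Rightarrow> 'b \<Rightarrow> real"
  assumes "A < B" and "lam > 0"
    and "\<And>t. t \<in> {A..B} \<Longrightarrow> (f has_real_derivative f' t) (at t within {A..B})"
    and "\<And>t. t \<in> {A..B} \<Longrightarrow> (f' has_real_derivative f'' t) (at t within {A..B})"
    and "continuous_on {A..B} f''"
    and "\<And>t. t \<in> {A..B} \<Longrightarrow> f t \<noteq> 0"
    and "\<And>N. N \<ge> 2 \<Longrightarrow> ar1_errors (M N) N (exp (- lam * design_step A B N)) (\<epsilon> N) (z N)"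
  shows "((\<lambda>N. prob_space.variance (M N)
            (\<lambda>\<omega>. slse N
               (optimal_weight N (error_cov (M N) N (\<epsilon> N)) (\<lambda>j. f (design_pt A B N j)))
               (\<lambda>j. f (design_pt A B N j))
               (\<lambda>j. \<theta> * f (design_pt A B N j) + \<epsilon> N j \<omega>)))
          \<longlonglongrightarrow> D_star lam f f' f'' A B)
       \<and> (continuous_ar1_process Mc lam A B \<epsilon>c \<longrightarrow>
          prob_space.variance Mc
            (\<lambda>\<omega>. continuous_slse lam f f' f'' A B (\<lambda>t. \<theta> * f t + \<epsilon>c t \<omega>))
          = D_star lam f f' f'' A B)"
proof -
  interpret ar1_regression A B lam f f' f'' using assms(1-6) by unfold_locales
  show ?thesis
    unfolding D_star_eq using discrete_variance_tendsto[OF assms(7)] continuous_variance by blast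
qed

end
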